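(* Let $n\geq3$, $D=\{0,\dots,n-1\}$, and let $\preceq\ \subseteq D^2$ be a bounded order relation on $D$ with bottom element $\bot$ and top element $\top$. There do not exist parameters $a,b\in D$ such that $\mathrm{Pol}(R^{(a)}_{(b)})\subseteq\mathrm{Pol}(\preceq)$.
   Context: $D=\{0,1,\dots,n-1\}$ carries its canonical linear order $\leq$. $\mathrm{O}_D$ is the set of all operations $D^k\to D$, $k\geq1$. A $k$-ary $f$ preserves a relation $\varrho\subseteq D^m$ if for all $r_1,\dots,r_k\in\varrho$ the tuple obtained by applying $f$ componentwise to $r_1,\dots,r_k$ lies in $\varrho$; $\mathrm{Pol}(\varrho)$ is the set of all $f\in\mathrm{O}_D$ preserving $\varrho$. For $a,b\in D$, $R^{(a)}_{(b)}=\{(x,y)\in D^2: x\geq a\text{ or }y\leq b\}$ (with respect to the canonical order). A bounded order relation is a partial order relation having both a largest element $\top$ and a least element $\bot$. *)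

theory Defs
  imports Main
begin

text \<open>An operation on \<open>D\<close> is a pair \<open>(k, f)\<close> of an arity \<open>k \<ge> 1\<close> and a map from the lists of
  length \<open>k\<close> over \<open>D\<close> (that is, \<open>D\<^sup>k\<close>) to \<open>D\<close>. The map is required to be \<open>undefined\<close> off \<open>D\<^sup>k\<close>, so
  that equality of pairs is equality of operations.\<close>

definition tuples :: "'a set \<Rightarrow> nat \<Rightarrow> 'a list set" where
  "tuples D k = {xs. length xs = k \<and> set xs \<subseteq> D}"

definition operations :: "'a set \<Rightarrow> (nat \<times> ('a list \<Rightarrow> 'a)) set" where
  "operations D =
     {(k, f). k \<ge> 1 \<and> (\<forall>xs \<in> tuples D k. f xs \<in> D) \<and> (\<forall>xs. xs \<notin> tuples D k \<longrightarrow> f xs = undefined)}"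

text \<open>Here \<open>rho\<close> is an \<open>m\<close>-ary relation, given as a set of lists of length \<open>m\<close>; the arity \<open>m\<close> is
  a parameter, because it cannot be recovered from an empty relation.\<close>

definition preserves :: "nat \<times> ('a list \<Rightarrow> 'a) \<Rightarrow> nat \<Rightarrow> 'a list set \<Rightarrow> bool" where
  "preserves F m rho \<longleftrightarrow>
     (\<forall>rs. length rs = fst F \<and> set rs \<subseteq> rho \<longrightarrow>
        map (\<lambda>i. snd F (map (\<lambda>r. r ! i) rs)) [0..<m] \<in> rho)"

definition Pol :: "'a set \<Rightarrow> nat \<Rightarrow> 'a list set \<Rightarrow> (nat \<times> ('a list \<Rightarrow> 'a)) set" where
  "Pol D m rho = {F \<in> operations D. preserves F m rho}"

definition Pol2 :: "'a set \<Rightarrow> ('a \<times> 'a) set \<Rightarrow> (nat \<times> ('a list \<Rightarrow> 'a)) set" where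
  "Pol2 D R = Pol D 2 {[x, y] | x y. (x, y) \<in> R}"

definition R_rel :: "'a::linorder set \<Rightarrow> 'a \<Rightarrow> 'a \<Rightarrow> ('a \<times> 'a) set" where
  "R_rel D a b = {(x, y) \<in> D \<times> D. x \<ge> a \<or> y \<le> b}"

definition bounded_order_on :: "'a set \<Rightarrow> ('a \<times> 'a) set \<Rightarrow> 'a \<Rightarrow> 'a \<Rightarrow> bool" where
  "bounded_order_on D le bt tp \<longleftrightarrow>
     partial_order_on D le \<and>
     bt \<in> D \<and> (\<forall>x \<in> D. (bt, x) \<in> le) \<and>
     tp \<in> D \<and> (\<forall>x \<in> D. (x, tp) \<in> le)"

end

theory Submission
  imports Defs
begin

text \<open>
  For each pair of parameters there is a binary operation that preserves \<open>R_rel D a b\<close> but not the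
  bounded order. Since \<open>(m, m)\<close> and \<open>(bt, tp)\<close> lie in the order for every \<open>m \<in> D\<close>, a binary
  operation \<open>g\<close> that preserves the order must satisfy \<open>g m bt \<preceq> g m tp\<close>; the operations below
  violate exactly this.

  If \<open>a < n - 1\<close>, then all pairs from \<open>{a, a + 1}\<close> belong to \<open>R_rel D a b\<close>; if \<open>b > 0\<close>, so do
  all pairs from \<open>{0, b}\<close>. A set with this property that has two elements is already enough
  (\<open>square_subset_not_Pol2_subset\<close>): every operation with values in such a set preserves the
  relation, and antisymmetry lets one of them send \<open>bt\<close> and \<open>tp\<close> to values that are not in order.

  Only \<open>a = n - 1\<close>, \<open>b = 0\<close> remains, where the relation says \<open>x = n - 1 \<or> y = 0\<close>. Unary
  operations need not be enough here: those that preserve the relation are the constants and the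
  maps that fix both \<open>0\<close> and \<open>n - 1\<close>, and they are all monotone if \<open>n = 3\<close> and the order is
  \<open>0 \<preceq> 1 \<preceq> 2\<close>. But a binary operation that returns its first argument whenever that is \<open>0\<close> or
  \<open>n - 1\<close> preserves the relation, no matter what it does with the other first arguments
  (\<open>extreme_not_Pol2_subset\<close>). As \<open>n \<ge> 3\<close>, there is another first argument, and there the
  operation may exchange \<open>bt\<close> and \<open>tp\<close>.
\<close>

definition binary_op :: "'a set \<Rightarrow> ('a \<Rightarrow> 'a \<Rightarrow> 'a) \<Rightarrow> nat \<times> ('a list \<Rightarrow> 'a)" where
  "binary_op D g = (2, \<lambda>xs. if xs \<in> tuples D 2 then g (xs ! 0) (xs ! 1) else undefined)"

lemma binary_op_in_Pol2_iff:
  assumes closed: "\<And>x y. x \<in> D \<Longrightarrow> y \<in> D \<Longrightarrow> g x y \<in> D"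
    and R: "R \<subseteq> D \<times> D"
  shows "binary_op D g \<in> Pol2 D R \<longleftrightarrow>
    (\<forall>x y x' y'. (x, y) \<in> R \<longrightarrow> (x', y') \<in> R \<longrightarrow> (g x x', g y y') \<in> R)"
proof -
  have op: "binary_op D g \<in> operations D"
    using closed by (auto simp: binary_op_def operations_def tuples_def length_Suc_conv
        numeral_2_eq_2)
  let ?L = "{[x, y] | x y. (x, y) \<in> R}"
  have upt: "[0..<2] = [0, Suc 0]" by (simp add: upt_rec numeral_2_eq_2)
  have apply_op: "map (\<lambda>i. snd (binary_op D g) (map (\<lambda>r. r ! i) [[x, y], [x', y']])) [0..<2]
      = [g x x', g y y']" if "(x, y) \<in> R" "(x', y') \<in> R" for x y x' y'
    using that R by (auto simp: upt binary_op_def tuples_def)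
  have "preserves (binary_op D g) 2 ?L \<longleftrightarrow>
    (\<forall>x y x' y'. (x, y) \<in> R \<longrightarrow> (x', y') \<in> R \<longrightarrow> (g x x', g y y') \<in> R)" (is "?P \<longleftrightarrow> ?Q")
  proof
    assume P: ?P
    show ?Q
    proof (intro allI impI)
      fix x y x' y' assume xy: "(x, y) \<in> R" "(x', y') \<in> R"
      have "map (\<lambda>i. snd (binary_op D g) (map (\<lambda>r. r ! i) [[x, y], [x', y']])) [0..<2] \<in> ?L"
        using P xy unfolding preserves_def
        by (elim allE[where x = "[[x, y], [x', y']]"]) (auto simp: binary_op_def)
      then show "(g x x', g y y') \<in> R"
        unfolding apply_op[OF xy] by simp
    qed
  next
    assume Q: ?Q
    show ?P unfolding preserves_def
    proof (intro allI impI)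
      fix rs assume "length rs = fst (binary_op D g) \<and> set rs \<subseteq> ?L"
      then obtain x y x' y' where rs: "rs = [[x, y], [x', y']]"
        and xy: "(x, y) \<in> R" "(x', y') \<in> R"
        by (auto simp: binary_op_def length_Suc_conv numeral_2_eq_2)
      show "map (\<lambda>i. snd (binary_op D g) (map (\<lambda>r. r ! i) rs)) [0..<2] \<in> ?L"
        unfolding rs apply_op[OF xy] using Q xy by simp
    qed
  qed
  then show ?thesis using op by (simp add: Pol2_def Pol_def)
qed

text \<open>The common test: the pairs \<open>(m, m)\<close> and \<open>(bt, tp)\<close> lie in every bounded order, so the
  operation \<open>g\<close> must respect them.\<close>

lemma not_Pol2_subset_bounded_order:
  assumes le: "bounded_order_on D le bt tp"
    and R: "R \<subseteq> D \<times> D"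
    and closed: "\<And>x y. x \<in> D \<Longrightarrow> y \<in> D \<Longrightarrow> g x y \<in> D"
    and preserves_R:
      "\<And>x y x' y'. (x, y) \<in> R \<Longrightarrow> (x', y') \<in> R \<Longrightarrow> (g x x', g y y') \<in> R"
    and m: "m \<in> D"
    and violation: "(g m bt, g m tp) \<notin> le"
  shows "\<not> Pol2 D R \<subseteq> Pol2 D le"
proof
  assume sub: "Pol2 D R \<subseteq> Pol2 D le"
  have le_sub: "le \<subseteq> D \<times> D"
    using le by (auto simp: bounded_order_on_def partial_order_on_def preorder_on_def refl_on_def)
  have mm: "(m, m) \<in> le" and bt_tp: "(bt, tp) \<in> le"
    using le m by (auto simp: bounded_order_on_def partial_order_on_def preorder_on_def refl_on_def)
  have "binary_op D g \<in> Pol2 D R"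
    by (simp add: binary_op_in_Pol2_iff[of D g R, OF closed R] preserves_R)
  then have "binary_op D g \<in> Pol2 D le" using sub by blast
  then have "(g m bt, g m tp) \<in> le"
    using mm bt_tp by (simp add: binary_op_in_Pol2_iff[of D g le, OF closed le_sub])
  with violation show False by contradiction
qed

text \<open>Every operation with values in \<open>S\<close> preserves \<open>R\<close>, so the values at \<open>bt\<close> and at \<open>tp\<close> can
  be chosen freely in \<open>S\<close>, in particular out of order.\<close>

lemma square_subset_not_Pol2_subset:
  assumes le: "bounded_order_on D le bt tp"
    and R: "R \<subseteq> D \<times> D"
    and S: "S \<times> S \<subseteq> R" "u \<in> S" "v \<in> S" "u \<noteq> v"
    and bt_tp: "bt \<noteq> tp"
  shows "\<not> Pol2 D R \<subseteq> Pol2 D le"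
proof -
  have "antisym le"
    using le by (simp add: bounded_order_on_def partial_order_on_def)
  then obtain p q where pq: "p \<in> S" "q \<in> S" "(p, q) \<notin> le"
    using S(2-4) by (metis antisymD)
  then have D: "p \<in> D" "q \<in> D" using S R by auto
  let ?g = "\<lambda>_ y. if y = bt then p else q"
  show ?thesis
  proof (rule not_Pol2_subset_bounded_order[where g = ?g and m = bt, OF le R])
    show "bt \<in> D" using le by (simp add: bounded_order_on_def)
  qed (use D pq S bt_tp in auto)
qed

text \<open>The operation below equals its first argument at the two ends \<open>0\<close> and \<open>n - 1\<close>. Hence a
  pair of first arguments with \<open>x = n - 1\<close> or \<open>y = 0\<close> yields a pair of values with the same
  property, and the values at the remaining first arguments are free to reverse \<open>bt\<close> and \<open>tp\<close>.\<close>

lemma extreme_not_Pol2_subset: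
  fixes n :: nat
  assumes n: "n \<ge> 3"
    and le: "bounded_order_on {0..<n} le bt tp"
    and bt_tp: "bt \<noteq> tp"
  shows "\<not> Pol2 {0..<n} (R_rel {0..<n} (n - 1) 0) \<subseteq> Pol2 {0..<n} le"
proof -
  let ?g = "\<lambda>x y. if x = 0 \<or> x = n - 1 then x else if y = bt then tp else bt"
  have ends: "bt < n" "tp < n" and "antisym le" "(bt, tp) \<in> le"
    using le by (auto simp: bounded_order_on_def partial_order_on_def)
  then have "(tp, bt) \<notin> le" using bt_tp by (metis antisymD)
  then show ?thesis
    using n ends bt_tp
    by (intro not_Pol2_subset_bounded_order[where g = ?g and m = 1, OF le])
      (auto simp: R_rel_def)
qed

theorem proposition4p5:
  fixes n :: nat and D :: "nat set" and le :: "(nat \<times> nat) set" and bt tp :: nat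
  assumes "n \<ge> 3"
    and "D = {0..<n}"
    and "bounded_order_on D le bt tp"
  shows "\<not> (\<exists>a \<in> D. \<exists>b \<in> D. Pol2 D (R_rel D a b) \<subseteq> Pol2 D le)"
proof -
  have "\<not> Pol2 D (R_rel D a b) \<subseteq> Pol2 D le" if ab: "a \<in> D" "b \<in> D" for a b
  proof -
    have R: "R_rel D a b \<subseteq> D \<times> D" by (auto simp: R_rel_def)
    have bt_tp: "bt \<noteq> tp"
    proof
      assume "bt = tp"
      then have "(0, bt) \<in> le" "(bt, 0) \<in> le" "(1, bt) \<in> le" "(bt, 1) \<in> le" "antisym le"
        using assms by (auto simp: bounded_order_on_def partial_order_on_def)
      then show False by (metis antisymD zero_neq_one)
    qed
    consider "a < n - 1" | "b > 0" | "a = n - 1" "b = 0"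
      using ab assms(2) by fastforce
    then show ?thesis
    proof cases
      case 1
      then show ?thesis
        using assms(2)
        by (intro square_subset_not_Pol2_subset[where S = "{a, a + 1}" and u = a and v = "a + 1",
              OF assms(3) R _ _ _ _ bt_tp]) (auto simp: R_rel_def)
    next
      case 2
      then show ?thesis
        using ab assms(2)
        by (intro square_subset_not_Pol2_subset[where S = "{0, b}" and u = 0 and v = b,
              OF assms(3) R _ _ _ _ bt_tp]) (auto simp: R_rel_def)
    next
      case 3
      then show ?thesis
        using extreme_not_Pol2_subset[of n le bt tp] assms bt_tp by simp
    qed
  qed
  then show ?thesis by blast
qed

end
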